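(* For integers $n,i,j\ge0$ and $m\in\{1,2\}$, the number of partitions counted by $A_m(n)$ that have exactly $i$ parts $\equiv2\pmod3$ and exactly $j$ parts $\equiv1\pmod3$ equals the number of partitions counted by $C_m(n)$ that have exactly $i$ parts $\equiv 3m-1\pmod6$ and exactly $j$ parts $\equiv 3m+1\pmod 6$.
   Context: For a partition $\pi=(\pi_1\ge\pi_2\ge\cdots)$, the parts $\pi_1,\pi_3,\dots$ are odd-indexed and $\pi_2,\pi_4,\dots$ are even-indexed. $A_m(n)$ is the number of partitions $\pi$ of $n$ into distinct parts such that for no integer $l\ge0$ are both $3l+1$ and $3l+2$ parts of $\pi$, and such that: if $m=1$, every odd-indexed part is $\not\equiv1\pmod3$ and every even-indexed part is $\not\equiv2\pmod3$; if $m=2$, every odd-indexed part is $\not\equiv2\pmod3$ and every even-indexed part is $\not\equiv1\pmod3$. $C_m(n)$ is the number of partitions of $n$ into distinct parts $\not\equiv\pm m\pmod6$. *)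

theory Defs
  imports "HOL-Number_Theory.Cong"
begin

text \<open>
  A partition is the list of its parts in weakly decreasing order, all parts being positive.
  The empty list is the only partition of 0.
\<close>

definition partition_of :: "nat list \<Rightarrow> nat \<Rightarrow> bool" where
  "partition_of \<pi> n \<longleftrightarrow> sorted_wrt (\<ge>) \<pi> \<and> (\<forall>p\<in>set \<pi>. 0 < p) \<and> sum_list \<pi> = n"

text \<open>
  Parts are indexed from 1, whereas list positions start at 0; only indices
  \<open>k\<close> with \<open>1 \<le> k \<le> length \<pi>\<close> are meaningful.
\<close>

definition part :: "nat list \<Rightarrow> nat \<Rightarrow> nat" where
  "part \<pi> k = \<pi> ! (k - 1)"

text \<open>Residues are integers because \<open>C_partitions\<close> refers to the residue \<open>- m\<close>.\<close>

definition num_parts_cong :: "nat list \<Rightarrow> int \<Rightarrow> int \<Rightarrow> nat" where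
  "num_parts_cong \<pi> r q = length (filter (\<lambda>p. [int p = r] (mod q)) \<pi>)"

definition odd_indexed_parts_avoid :: "nat list \<Rightarrow> int \<Rightarrow> int \<Rightarrow> bool" where
  "odd_indexed_parts_avoid \<pi> r q \<longleftrightarrow>
     (\<forall>k\<in>{1..length \<pi>}. odd k \<longrightarrow> \<not> [int (part \<pi> k) = r] (mod q))"

definition even_indexed_parts_avoid :: "nat list \<Rightarrow> int \<Rightarrow> int \<Rightarrow> bool" where
  "even_indexed_parts_avoid \<pi> r q \<longleftrightarrow>
     (\<forall>k\<in>{1..length \<pi>}. even k \<longrightarrow> \<not> [int (part \<pi> k) = r] (mod q))"

text \<open>
  The partitions counted by $A_m(n)$ and $C_m(n)$; both are only meant for \<open>m \<in> {1, 2}\<close>.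
\<close>

definition A_partitions :: "nat \<Rightarrow> nat \<Rightarrow> nat list set" where
  "A_partitions m n =
     {\<pi>. partition_of \<pi> n \<and> distinct \<pi> \<and>
          \<not> (\<exists>l::nat. 3 * l + 1 \<in> set \<pi> \<and> 3 * l + 2 \<in> set \<pi>) \<and>
          (m = 1 \<longrightarrow> odd_indexed_parts_avoid \<pi> 1 3 \<and> even_indexed_parts_avoid \<pi> 2 3) \<and>
          (m = 2 \<longrightarrow> odd_indexed_parts_avoid \<pi> 2 3 \<and> even_indexed_parts_avoid \<pi> 1 3)}"

definition C_partitions :: "nat \<Rightarrow> nat \<Rightarrow> nat list set" where
  "C_partitions m n =
     {\<pi>. partition_of \<pi> n \<and> distinct \<pi> \<and>
          (\<forall>p\<in>set \<pi>. \<not> [int p = int m] (mod 6) \<and> \<not> [int p = - int m] (mod 6))}"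

text \<open>Both sets are finite, so that \<^const>\<open>card\<close> really counts their elements.\<close>

lemma finite_partitions_of: "finite {\<pi>. partition_of \<pi> n}"
proof (rule finite_subset)
  show "{\<pi>. partition_of \<pi> n} \<subseteq> {\<pi>. set \<pi> \<subseteq> {..n} \<and> length \<pi> \<le> n}"
  proof
    fix \<pi> assume "\<pi> \<in> {\<pi>. partition_of \<pi> n}"
    then have pos: "\<forall>p\<in>set \<pi>. 0 < p" and sum: "sum_list \<pi> = n"
      by (auto simp: partition_of_def)
    have "length \<pi> \<le> sum_list \<pi>"
      using pos by (induction \<pi>) auto
    moreover have "set \<pi> \<subseteq> {..sum_list \<pi>}"
      by (auto intro: member_le_sum_list)
    ultimately show "\<pi> \<in> {\<pi>. set \<pi> \<subseteq> {..n} \<and> length \<pi> \<le> n}"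
      using sum by auto
  qed
  show "finite {\<pi>. set \<pi> \<subseteq> {..n} \<and> length \<pi> \<le> n}"
    by (rule finite_lists_length_le) simp
qed

lemma finite_A_partitions: "finite (A_partitions m n)"
  by (rule finite_subset[OF _ finite_partitions_of]) (auto simp: A_partitions_def)

lemma finite_C_partitions: "finite (C_partitions m n)"
  by (rule finite_subset[OF _ finite_partitions_of]) (auto simp: C_partitions_def)

end

theory Submission
  imports Defs "HOL-Computational_Algebra.Formal_Power_Series"
begin

text \<open>
  Let \<open>u\<^sub>L(i,j)\<close> and \<open>v\<^sub>L(i,j)\<close> be the generating functions of the partitions counted by
  $A_1$ and $A_2$ with parts at most \<open>3L\<close>, with \<open>i\<close> parts $\equiv 2$ and \<open>j\<close> parts $\equiv 1$
  modulo 3. Removing the largest part yields coupled recurrences in \<open>L\<close>, whose solution is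
  \<open>X\<^sup>e (-X\<^sup>3;X\<^sup>3)\<^sub>k [L; i,j,k]\<close> with \<open>k = L - i - j\<close> and a trinomial coefficient in base
  \<open>X\<^sup>6\<close>; only the exponent \<open>e\<close> distinguishes \<open>u\<close> from \<open>v\<close>. The same product counts triples of
  an \<open>i\<close>-subset of the first \<open>L\<close> numbers in one residue class modulo 6, a \<open>j\<close>-subset of the
  first \<open>L - i\<close> numbers in another, and a subset of \<open>{3, 6, \<dots>, 3k}\<close>. As soon as
  \<open>L \<ge> n + i + j\<close>, these bounds exclude no partition of \<open>n\<close>.
\<close>

section \<open>Generating functions of finite weighted sets\<close>

text \<open>Integer coefficients, although the sums count: the proof works with factors
  \<open>1 - X^(6 t)\<close>, and cancelling them calls for an integral domain.\<close>

definition gf :: "('a \<Rightarrow> nat) \<Rightarrow> 'a set \<Rightarrow> int fps" where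
  "gf w S = (\<Sum>s\<in>S. fps_X ^ w s)"

lemma gf_empty [simp]: "gf w {} = 0"
  by (simp add: gf_def)

lemma fps_nth_gf: "finite S \<Longrightarrow> fps_nth (gf w S) n = int (card {s \<in> S. w s = n})"
  by (simp add: gf_def fps_sum_nth fps_X_power_nth eq_commute[of n]
      flip: sum.inter_filter)

lemma gf_Un: "\<lbrakk>finite S; finite T; S \<inter> T = {}\<rbrakk> \<Longrightarrow> gf w (S \<union> T) = gf w S + gf w T"
  unfolding gf_def by (rule sum.union_disjoint)

lemma gf_image:
  assumes "inj_on f S" "\<And>s. s \<in> S \<Longrightarrow> w (f s) = c + v s"
  shows "gf w (f ` S) = fps_X ^ c * gf v S"
  using assms by (simp add: gf_def sum.reindex power_add sum_distrib_left)

lemma gf_Times: "gf (\<lambda>(s, t). v s + w t) (S \<times> T) = gf v S * gf w T"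
  by (simp add: gf_def sum_product sum.cartesian_product power_add case_prod_unfold)

text \<open>Brings the new factor of \<open>qp (Suc i)\<close> or \<open>qp (Suc k)\<close> to the
  front, which leaves the product of an induction hypothesis.\<close>

lemma pull_factor:
  fixes c :: "'a::comm_monoid_mult"
  shows "f * ((c * p) * q) = c * (f * (p * q))" "f * (p * (c * q)) = c * (f * (p * q))"
  by (simp_all only: mult_ac)

text \<open>For terms that a recurrence multiplies by a power of \<open>X\<close>: comparing
  exponents becomes an arithmetic side condition.\<close>

lemma shift_power:
  fixes x :: "'a::comm_monoid_mult"
  assumes "f * d = x ^ a * c * M" "b + a = e"
  shows "x ^ b * f * d = x ^ e * c * M"
  using assms(1) unfolding assms(2)[symmetric] power_add by (simp only: mult.assoc)

section \<open>Subsets of arithmetic progressions\<close>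

text \<open>In q-series notation \<open>qp k\<close> is \<open>(X^6; X^6)_k\<close> and
  \<open>qm k\<close> is \<open>(-X^3; X^3)_k\<close>.\<close>

definition qp :: "nat \<Rightarrow> int fps" where
  "qp k = (\<Prod>t=1..k. 1 - fps_X ^ (6 * t))"

definition qm :: "nat \<Rightarrow> int fps" where
  "qm k = (\<Prod>t=1..k. 1 + fps_X ^ (3 * t))"

lemma qp_0 [simp]: "qp 0 = 1" and qm_0 [simp]: "qm 0 = 1"
  by (simp_all add: qp_def qm_def)

lemma qp_Suc: "qp (Suc k) = (1 - fps_X ^ (6 * Suc k)) * qp k"
  and qm_Suc: "qm (Suc k) = (1 + fps_X ^ (3 * Suc k)) * qm k"
  by (simp_all add: qp_def qm_def mult.commute)

lemma qp_nonzero: "qp k \<noteq> 0"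
proof -
  have "fps_nth (qp k) 0 = 1"
    by (induction k) (simp_all add: qp_Suc fps_X_power_nth)
  then show ?thesis by auto
qed

text \<open>The smallest possible sum of an \<open>i\<close>-subset of
  \<open>r, r + 6, r + 12, ...\<close>, hence the lowest exponent in the generating function of
  these subsets.\<close>

definition least_sum :: "nat \<Rightarrow> nat \<Rightarrow> nat" where
  "least_sum r i = (\<Sum>t<i. 6 * t + r)"

lemma least_sum_0 [simp]: "least_sum r 0 = 0"
  and least_sum_Suc [simp]: "least_sum r (Suc i) = least_sum r i + 6 * i + r"
  by (simp_all add: least_sum_def)

lemma least_sum_add: "least_sum (r + c) i = least_sum r i + c * i"
  by (induction i) simp_all

definition progression :: "nat \<Rightarrow> nat \<Rightarrow> nat set" where
  "progression r L = (\<lambda>t. 6 * t + r) ` {..<L}"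

lemma finite_progression [simp]: "finite (progression r L)"
  by (simp add: progression_def)

lemma progression_0 [simp]: "progression r 0 = {}"
  and progression_Suc: "progression r (Suc L) = insert (6 * L + r) (progression r L)"
  and last_notin_progression: "6 * L + r \<notin> progression r L"
  by (auto simp: progression_def lessThan_Suc)

lemma in_progression_iff:
  "r < 6 \<Longrightarrow> p \<in> progression r L \<longleftrightarrow> p mod 6 = r \<and> p div 6 < L"
  by (auto simp: progression_def intro!: image_eqI[of _ _ "p div 6"])

definition subsets :: "'a set \<Rightarrow> nat \<Rightarrow> 'a set set" where
  "subsets A i = {S. S \<subseteq> A \<and> card S = i}"

lemma finite_subsets [simp]: "finite A \<Longrightarrow> finite (subsets A i)"
  by (simp add: subsets_def)

lemma subsets_0: "finite A \<Longrightarrow> subsets A 0 = {{}}"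
  by (auto simp: subsets_def card_eq_0_iff dest: finite_subset)

lemma subsets_eq_empty: "finite A \<Longrightarrow> card A < i \<Longrightarrow> subsets A i = {}"
  by (auto simp: subsets_def dest: card_mono)

lemma gf_subsets_insert:
  assumes "finite A" "a \<notin> A"
  shows "gf \<Sum> (subsets (insert a A) (Suc i)) =
           gf \<Sum> (subsets A (Suc i)) + fps_X ^ a * gf \<Sum> (subsets A i)"
proof -
  have "subsets (insert a A) (Suc i) = subsets A (Suc i) \<union> insert a ` subsets A i"
  proof (intro set_eqI iffI)
    fix S assume S: "S \<in> subsets (insert a A) (Suc i)"
    show "S \<in> subsets A (Suc i) \<union> insert a ` subsets A i"
    proof (cases "a \<in> S")
      case True
      then have "S = insert a (S - {a})" "S - {a} \<in> subsets A i"
        using S by (auto simp: subsets_def)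
      then show ?thesis by blast
    qed (use S in \<open>auto simp: subsets_def\<close>)
  next
    fix S assume "S \<in> subsets A (Suc i) \<union> insert a ` subsets A i"
    then show "S \<in> subsets (insert a A) (Suc i)"
      using assms by (auto simp: subsets_def) (metis card_insert_disjoint finite_subset subsetD)
  qed
  moreover have "subsets A (Suc i) \<inter> insert a ` subsets A i = {}"
    using assms(2) by (auto simp: subsets_def)
  moreover have "gf \<Sum> (insert a ` subsets A i) = fps_X ^ a * gf \<Sum> (subsets A i)"
  proof (rule gf_image)
    show "inj_on (insert a) (subsets A i)"
      using assms(2) by (auto simp: inj_on_def subsets_def insert_ident)
    show "\<Sum> (insert a S) = a + \<Sum> S" if "S \<in> subsets A i" for S
      using that assms by (subst sum.insert) (auto simp: subsets_def dest: finite_subset)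
  qed
  ultimately show ?thesis
    using assms(1) by (simp add: gf_Un)
qed

text \<open>The Gaussian binomial coefficient in base \<open>X^6\<close>, freed of denominators.
  Deciding whether the largest element is chosen gives the q-Pascal rule.\<close>

lemma gf_subsets_progression:
  "gf \<Sum> (subsets (progression r (i + k)) i) * (qp i * qp k) =
     fps_X ^ least_sum r i * qp (i + k)"
proof (induction "i + k" arbitrary: i k)
  case 0
  then show ?case by (simp add: subsets_0 gf_def)
next
  case (Suc L)
  show ?case
  proof (cases i)
    case 0
    then show ?thesis by (simp add: subsets_0 gf_def)
  next
    case i: (Suc i')
    have L: "L = i' + k" using Suc.hyps i by simp
    let ?g = "\<lambda>i. gf \<Sum> (subsets (progression r L) i)"
    have split: "gf \<Sum> (subsets (progression r (i + k)) i) = ?g i + fps_X ^ (6 * L + r) * ?g i'"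
      using gf_subsets_insert[OF finite_progression last_notin_progression]
      by (simp add: progression_Suc flip: Suc.hyps) (simp add: i)
    have "?g i * (qp i * qp k) =
            fps_X ^ least_sum r i * (1 - fps_X ^ (6 * k)) * qp L"
    proof (cases k)
      \<comment> \<open>Only \<open>L = i - 1\<close> elements are available, so there is no such
        subset; on the right \<open>1 - X^(6 k)\<close> is zero.\<close>
      case 0
      have "card (progression r L) < i"
        using card_image_le[of "{..<L}" "\<lambda>t. 6 * t + r"] L 0 i
        by (simp add: progression_def)
      then show ?thesis by (simp add: 0 subsets_eq_empty)
    next
      case (Suc k')
      have "?g i * (qp i * qp k') = fps_X ^ least_sum r i * qp L"
        using Suc.hyps(1)[of i k'] L i Suc by simp
      then show ?thesis
        unfolding Suc qp_Suc by (subst pull_factor(2)) (simp only: mult_ac)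
    qed
    moreover have "fps_X ^ (6 * L + r) * ?g i' * (qp i * qp k) =
        fps_X ^ (least_sum r i + 6 * k) * (1 - fps_X ^ (6 * i)) * qp L"
    proof (rule shift_power)
      have "?g i' * (qp i' * qp k) = fps_X ^ least_sum r i' * qp L"
        using Suc.hyps(1)[of i' k] L by simp
      then show "?g i' * (qp i * qp k) = fps_X ^ least_sum r i' * (1 - fps_X ^ (6 * i)) * qp L"
        unfolding i qp_Suc by (subst pull_factor(1)) (simp only: mult_ac)
      show "6 * L + r + least_sum r i' = least_sum r i + 6 * k"
        using L by (simp add: i)
    qed
    ultimately have "gf \<Sum> (subsets (progression r (i + k)) i) * (qp i * qp k) =
        fps_X ^ least_sum r i * (1 - fps_X ^ (6 * k)) * qp L +
        fps_X ^ (least_sum r i + 6 * k) * (1 - fps_X ^ (6 * i)) * qp L"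
      unfolding split by (simp only: distrib_right)
    \<comment> \<open>\<open>(1 - X^(6 k)) + X^(6 k) (1 - X^(6 i)) = 1 - X^(6 (i + k))\<close>.\<close>
    also have "\<dots> = fps_X ^ least_sum r i * ((1 - fps_X ^ (6 * (i + k))) * qp L)"
      by (simp add: power_add algebra_simps)
    finally show ?thesis
      by (simp only: qp_Suc flip: Suc.hyps(2))
  qed
qed

text \<open>Each multiple \<open>3 t\<close> is absent or present, which gives the factor
  \<open>1 + X^(3 t)\<close>.\<close>

lemma gf_Pow_multiples: "gf \<Sum> (Pow ((\<lambda>t. 3 * t) ` {1..k})) = qm k"
proof (induction k)
  case 0
  then show ?case by (simp add: gf_def)
next
  case (Suc k)
  let ?A = "(\<lambda>t. 3 * t) ` {1..k}" and ?a = "3 * Suc k"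
  have eq: "(\<lambda>t. 3 * t) ` {1..Suc k} = insert ?a ?A"
    by (auto simp: atLeastAtMostSuc_conv)
  have notin: "?a \<notin> S" if "S \<subseteq> ?A" for S
    using that by auto
  have "gf \<Sum> (insert ?a ` Pow ?A) = fps_X ^ ?a * gf \<Sum> (Pow ?A)"
  proof (rule gf_image)
    show "inj_on (insert ?a) (Pow ?A)"
      using notin by (intro inj_onI) (metis PowD insert_ident)
    show "\<Sum> (insert ?a S) = ?a + \<Sum> S" if "S \<in> Pow ?A" for S
      using that notin by (subst sum.insert) (auto dest: finite_subset)
  qed
  moreover have "Pow ?A \<inter> insert ?a ` Pow ?A = {}"
    using notin by blast
  ultimately show ?case
    unfolding eq Pow_insert using Suc by (simp add: gf_Un qm_Suc ring_distribs)
qed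

section \<open>Partitions counted by $A_m$ with bounded parts\<close>

text \<open>
  For strictly decreasing lists the gap condition only concerns a part and its successor, and
  removing the largest part exchanges odd-indexed and even-indexed parts, that is, the two
  values of \<open>m\<close>.
\<close>

definition A_lists :: "nat \<Rightarrow> nat list set" where
  "A_lists m =
     {\<pi>. sorted_wrt (>) \<pi> \<and> (\<forall>p\<in>set \<pi>. 0 < p) \<and>
          \<not> (\<exists>l::nat. 3 * l + 1 \<in> set \<pi> \<and> 3 * l + 2 \<in> set \<pi>) \<and>
          odd_indexed_parts_avoid \<pi> (int m) 3 \<and>
          even_indexed_parts_avoid \<pi> (int (3 - m)) 3}"

lemma sorted_wrt_greater_iff: "sorted_wrt (>) xs \<longleftrightarrow> sorted_wrt (\<ge>) xs \<and> distinct xs"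
  for xs :: "nat list"
  by (induction xs) (auto simp: order.order_iff_strict)

lemma A_partitions_eq:
  "m \<in> {1, 2} \<Longrightarrow> A_partitions m n = {\<pi> \<in> A_lists m. sum_list \<pi> = n}"
  by (auto simp: A_partitions_def A_lists_def partition_of_def sorted_wrt_greater_iff)

lemma index_range_Cons: "{1..length (p # \<pi>)} = insert 1 (Suc ` {1..length \<pi>})"
  by (auto simp: image_Suc_atLeastAtMost)

lemma ball_parts_Cons:
  "(\<forall>k\<in>{1..length (p # \<pi>)}. Q k (part (p # \<pi>) k)) \<longleftrightarrow>
     Q 1 p \<and> (\<forall>k\<in>{1..length \<pi>}. Q (Suc k) (part \<pi> k))"
proof -
  have "part (p # \<pi>) 1 = p" "\<And>k. k \<in> {1..length \<pi>} \<Longrightarrow> part (p # \<pi>) (Suc k) = part \<pi> k"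
    by (auto simp: part_def nth_Cons')
  then show ?thesis
    unfolding index_range_Cons by (simp only: ball_simps cong: ball_cong)
qed

text \<open>Prepending a part raises every index by one, so the two parities change roles.\<close>

lemma indexed_parts_avoid_Cons:
  "odd_indexed_parts_avoid (p # \<pi>) r q \<longleftrightarrow>
     \<not> [int p = r] (mod q) \<and> even_indexed_parts_avoid \<pi> r q"
  "even_indexed_parts_avoid (p # \<pi>) r q \<longleftrightarrow> odd_indexed_parts_avoid \<pi> r q"
  using ball_parts_Cons[of p \<pi> "\<lambda>k x. odd k \<longrightarrow> \<not> [int x = r] (mod q)"]
    ball_parts_Cons[of p \<pi> "\<lambda>k x. even k \<longrightarrow> \<not> [int x = r] (mod q)"]
  by (simp_all add: odd_indexed_parts_avoid_def even_indexed_parts_avoid_def del: length_Cons)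

lemma int_cong_iff: "[int p = int r] (mod int q) \<longleftrightarrow> p mod q = r mod q"
  by (simp only: cong_int_iff) (simp add: cong_def)

lemma A_lists_Nil: "[] \<in> A_lists m"
  by (simp add: A_lists_def odd_indexed_parts_avoid_def even_indexed_parts_avoid_def)

lemma A_lists_distinct: "\<pi> \<in> A_lists m \<Longrightarrow> distinct \<pi>"
  unfolding A_lists_def sorted_wrt_greater_iff by blast

lemma A_lists_pos: "\<pi> \<in> A_lists m \<Longrightarrow> p \<in> set \<pi> \<Longrightarrow> 0 < p"
  by (simp add: A_lists_def)

text \<open>As the largest part, \<open>p\<close> can form a forbidden pair only with
  \<open>p - 1\<close>, and only if \<open>p\<close> is 2 modulo 3; this lowers the bound on the
  tail to \<open>p - 2\<close>. The shift of indices turns \<open>m\<close> into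
  \<open>3 - m\<close>.\<close>

lemma A_lists_Cons:
  assumes "m \<in> {1, 2}"
  shows "p # \<pi> \<in> A_lists m \<longleftrightarrow>
    0 < p \<and> p mod 3 \<noteq> m \<and> \<pi> \<in> A_lists (3 - m) \<and>
    set \<pi> \<subseteq> {..(if p mod 3 = 2 then p - 2 else p - 1)}"
    (is "_ \<longleftrightarrow> ?R")
proof -
  have res: "[int p = int m] (mod 3) \<longleftrightarrow> p mod 3 = m"
    using int_cong_iff[of p m 3] assms by auto
  let ?pair = "\<lambda>S. \<exists>l. 3 * l + 1 \<in> S \<and> 3 * l + 2 \<in> S"
  have bound: "(\<forall>x\<in>set \<pi>. x < p) \<and> \<not> ?pair (set (p # \<pi>)) \<longleftrightarrow>
      set \<pi> \<subseteq> {..(if p mod 3 = 2 then p - 2 else p - 1)} \<and> \<not> ?pair (set \<pi>)"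
    if "0 < p"
  proof -
    have "?pair (set (p # \<pi>)) \<longleftrightarrow> (p mod 3 = 2 \<and> p - 1 \<in> set \<pi>) \<or> ?pair (set \<pi>)"
      if less: "\<forall>x\<in>set \<pi>. x < p"
    proof
      assume "?pair (set (p # \<pi>))"
      then obtain l where "3 * l + 1 \<in> set (p # \<pi>)" "3 * l + 2 \<in> set (p # \<pi>)" by blast
      then consider "3 * l + 1 \<in> set \<pi>" "3 * l + 2 \<in> set \<pi>"
        | "3 * l + 1 \<in> set \<pi>" "p = 3 * l + 2" | "3 * l + 2 \<in> set \<pi>" "p = 3 * l + 1"
        by auto
      then show "(p mod 3 = 2 \<and> p - 1 \<in> set \<pi>) \<or> ?pair (set \<pi>)"
      proof cases
        case 1
        then show ?thesis by blast
      next
        case 2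
        then have "p mod 3 = 2" "p - 1 = 3 * l + 1" by presburger+
        with 2 show ?thesis by metis
      next
        case 3
        with less have "3 * l + 2 < 3 * l + 1" by blast
        then show ?thesis by simp
      qed
    next
      assume "(p mod 3 = 2 \<and> p - 1 \<in> set \<pi>) \<or> ?pair (set \<pi>)"
      then show "?pair (set (p # \<pi>))"
      proof
        assume p: "p mod 3 = 2 \<and> p - 1 \<in> set \<pi>"
        then have "3 * (p div 3) + 2 = p" "3 * (p div 3) + 1 = p - 1"
          using div_mult_mod_eq[of p 3] by linarith+
        with p show ?thesis by (intro exI[of _ "p div 3"]) simp
      qed auto
    qed
    moreover have "(\<forall>x\<in>set \<pi>. x < p) \<and> \<not> (p mod 3 = 2 \<and> p - 1 \<in> set \<pi>) \<longleftrightarrow>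
        set \<pi> \<subseteq> {..(if p mod 3 = 2 then p - 2 else p - 1)}"
    proof (cases "p mod 3 = 2")
      case True
      then have "x < p \<and> x \<noteq> p - 1 \<longleftrightarrow> x \<le> p - 2" for x by presburger
      with True show ?thesis by (simp add: subset_iff) metis
    next
      case False
      have "x < p \<longleftrightarrow> x \<le> p - 1" for x using \<open>0 < p\<close> by auto
      with False show ?thesis by (auto simp: subset_iff)
    qed
    ultimately show ?thesis by meson
  qed
  have "p # \<pi> \<in> A_lists m \<longleftrightarrow> 0 < p \<and> p mod 3 \<noteq> m \<and>
      ((\<forall>x\<in>set \<pi>. x < p) \<and>
       \<not> (\<exists>l. 3 * l + 1 \<in> set (p # \<pi>) \<and> 3 * l + 2 \<in> set (p # \<pi>))) \<and>
      sorted_wrt (>) \<pi> \<and> (\<forall>p\<in>set \<pi>. 0 < p) \<and>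
      odd_indexed_parts_avoid \<pi> (int (3 - m)) 3 \<and> even_indexed_parts_avoid \<pi> (int m) 3"
    by (simp only: A_lists_def mem_Collect_eq indexed_parts_avoid_Cons res sorted_wrt.simps
        list.set ball_simps) blast
  also have "\<dots> \<longleftrightarrow> ?R"
  proof (cases "0 < p")
    case True
    have "3 - (3 - m) = m" using assms by auto
    then show ?thesis
      unfolding A_lists_def mem_Collect_eq bound[OF True] by (simp only:) blast
  qed simp
  finally show ?thesis .
qed

section \<open>Recurrences in the bound on the parts\<close>

definition count_mod3 :: "nat \<Rightarrow> nat list \<Rightarrow> nat" where
  "count_mod3 r \<pi> = length (filter (\<lambda>p. p mod 3 = r) \<pi>)"

lemma count_mod3_Nil [simp]: "count_mod3 r [] = 0"
  and count_mod3_Cons [simp]: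
    "count_mod3 r (p # \<pi>) = (if p mod 3 = r then 1 else 0) + count_mod3 r \<pi>"
  by (simp_all add: count_mod3_def)

definition A_bounded :: "nat \<Rightarrow> nat \<Rightarrow> nat \<Rightarrow> nat \<Rightarrow> nat list set" where
  "A_bounded m N i j =
     {\<pi> \<in> A_lists m. set \<pi> \<subseteq> {..N} \<and> count_mod3 2 \<pi> = i \<and> count_mod3 1 \<pi> = j}"

lemma finite_A_bounded [simp]: "finite (A_bounded m N i j)"
proof (rule finite_subset)
  show "A_bounded m N i j \<subseteq> {\<pi>. set \<pi> \<subseteq> {..N} \<and> distinct \<pi>}"
    unfolding A_bounded_def using A_lists_distinct by blast
  show "finite {\<pi>. set \<pi> \<subseteq> {..N} \<and> distinct \<pi>}"
    by (rule finite_subset_distinct) simp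
qed

abbreviation gf_A :: "nat \<Rightarrow> nat \<Rightarrow> nat \<Rightarrow> nat \<Rightarrow> int fps" where
  "gf_A m N i j \<equiv> gf sum_list (A_bounded m N i j)"

lemma A_bounded_0: "A_bounded m 0 i j = (if i = 0 \<and> j = 0 then {[]} else {})"
proof -
  have "\<pi> \<in> A_lists m \<and> set \<pi> \<subseteq> {..0} \<longleftrightarrow> \<pi> = []" for \<pi>
  proof (cases \<pi>)
    case (Cons p \<rho>)
    then show ?thesis using A_lists_pos[of \<pi> m p] by auto
  qed (simp add: A_lists_Nil)
  then have "\<pi> \<in> A_bounded m 0 i j \<longleftrightarrow> \<pi> = [] \<and> i = 0 \<and> j = 0" for \<pi>
    unfolding A_bounded_def by (metis (lifting) count_mod3_Nil mem_Collect_eq)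
  then show ?thesis by (intro set_eqI) simp
qed

text \<open>If \<open>Suc N\<close> occurs, it is the head of the decreasing list, and
  \<open>A_lists_Cons\<close> describes the tail. Where \<open>N - 1\<close> is used,
  \<open>N\<close> is positive.\<close>

lemma A_bounded_Suc:
  assumes "m \<in> {1, 2}"
  shows "A_bounded m (Suc N) i j = A_bounded m N i j \<union> Cons (Suc N) `
    {\<pi>. Suc N mod 3 \<noteq> m \<and>
        \<pi> \<in> A_lists (3 - m) \<and> set \<pi> \<subseteq> {..(if Suc N mod 3 = 2 then N - 1 else N)} \<and>
        count_mod3 2 (Suc N # \<pi>) = i \<and> count_mod3 1 (Suc N # \<pi>) = j}"
    (is "_ = _ \<union> Cons _ ` ?T")
proof (intro set_eqI iffI)
  fix \<pi> assume pi: "\<pi> \<in> A_bounded m (Suc N) i j"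
  show "\<pi> \<in> A_bounded m N i j \<union> Cons (Suc N) ` ?T"
  proof (cases "Suc N \<in> set \<pi>")
    case True
    then obtain p \<rho> where "\<pi> = p # \<rho>" by (cases \<pi>) auto
    moreover from this have "p = Suc N"
      using True pi by (auto simp: A_bounded_def A_lists_def)
    ultimately show ?thesis
      using pi A_lists_Cons[OF assms, of "Suc N" \<rho>]
      by (auto simp: A_bounded_def numeral_2_eq_2)
  qed (use pi in \<open>auto simp: A_bounded_def subset_iff le_Suc_eq\<close>)
next
  fix \<pi> assume "\<pi> \<in> A_bounded m N i j \<union> Cons (Suc N) ` ?T"
  then show "\<pi> \<in> A_bounded m (Suc N) i j"
  proof
    assume "\<pi> \<in> Cons (Suc N) ` ?T"
    then obtain \<rho> where rho: "\<pi> = Suc N # \<rho>" "\<rho> \<in> ?T" by blast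
    then have "set \<rho> \<subseteq> {..Suc N}"
      by (fastforce simp: subset_iff split: if_splits)
    moreover have "\<pi> \<in> A_lists m"
      unfolding rho(1) A_lists_Cons[OF assms] using rho(2) by (auto simp: numeral_2_eq_2)
    ultimately show ?thesis
      using rho by (auto simp: A_bounded_def)
  qed (auto simp: A_bounded_def)
qed

text \<open>The residue of \<open>Suc N\<close> and \<open>m\<close> decide whether
  \<open>Suc N\<close> may be the largest part. If so, the tail is counted for \<open>3 - m\<close>,
  with \<open>i\<close> or \<open>j\<close> lowered according to the residue; the zero alternatives
  cover a count that is already exhausted.\<close>

lemma gf_A_Suc:
  assumes "m \<in> {1, 2}"
  shows "Suc N mod 3 = m \<Longrightarrow> gf_A m (Suc N) i j = gf_A m N i j"
    and "Suc N mod 3 = 0 \<Longrightarrow>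
      gf_A m (Suc N) i j = gf_A m N i j + fps_X ^ Suc N * gf_A (3 - m) N i j"
    and "\<lbrakk>Suc N mod 3 = 1; m = 2\<rbrakk> \<Longrightarrow>
      gf_A m (Suc N) i j = gf_A m N i j +
        (if j = 0 then 0 else fps_X ^ Suc N * gf_A 1 N i (j - 1))"
    and "\<lbrakk>Suc N mod 3 = 2; m = 1\<rbrakk> \<Longrightarrow>
      gf_A m (Suc N) i j = gf_A m N i j +
        (if i = 0 then 0 else fps_X ^ Suc N * gf_A 2 (N - 1) (i - 1) j)"
proof -
  have disj: "A_bounded m N i j \<inter> Cons (Suc N) ` T = {}" for T
    by (auto simp: A_bounded_def)
  have add: "gf_A m (Suc N) i j = gf_A m N i j + fps_X ^ Suc N * gf_A m' N' i' j'"
    if "A_bounded m (Suc N) i j = A_bounded m N i j \<union> Cons (Suc N) ` A_bounded m' N' i' j'"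
    for m' N' i' j'
  proof -
    have "gf_A m (Suc N) i j = gf_A m N i j + gf sum_list (Cons (Suc N) ` A_bounded m' N' i' j')"
      unfolding that by (rule gf_Un) (simp_all add: disj)
    also have "gf sum_list (Cons (Suc N) ` A_bounded m' N' i' j') =
        fps_X ^ Suc N * gf_A m' N' i' j'"
      by (rule gf_image) simp_all
    finally show ?thesis .
  qed
  show "gf_A m (Suc N) i j = gf_A m N i j" if "Suc N mod 3 = m"
    using that by (simp add: A_bounded_Suc[OF assms])
  show "gf_A m (Suc N) i j = gf_A m N i j + fps_X ^ Suc N * gf_A (3 - m) N i j"
    if "Suc N mod 3 = 0"
  proof (rule add)
    have "m \<noteq> 0" using assms by auto
    then show "A_bounded m (Suc N) i j =
        A_bounded m N i j \<union> Cons (Suc N) ` A_bounded (3 - m) N i j"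
      unfolding A_bounded_Suc[OF assms] A_bounded_def[of "3 - m"] count_mod3_Cons that by simp
  qed
  show "gf_A m (Suc N) i j = gf_A m N i j +
      (if j = 0 then 0 else fps_X ^ Suc N * gf_A 1 N i (j - 1))" if "Suc N mod 3 = 1" "m = 2"
  proof (cases j)
    case 0
    then show ?thesis using that by (simp add: A_bounded_Suc)
  next
    case (Suc j')
    have "gf_A m (Suc N) i j = gf_A m N i j + fps_X ^ Suc N * gf_A 1 N i j'"
      by (rule add)
        (unfold A_bounded_Suc[OF assms], unfold that Suc A_bounded_def[of 1] count_mod3_Cons, simp)
    then show ?thesis using Suc by simp
  qed
  show "gf_A m (Suc N) i j = gf_A m N i j +
      (if i = 0 then 0 else fps_X ^ Suc N * gf_A 2 (N - 1) (i - 1) j)"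
    if "Suc N mod 3 = 2" "m = 1"
  proof (cases i)
    case 0
    then show ?thesis using that by (simp add: A_bounded_Suc)
  next
    case (Suc i')
    have "gf_A m (Suc N) i j = gf_A m N i j + fps_X ^ Suc N * gf_A 2 (N - 1) i' j"
      by (rule add)
        (unfold A_bounded_Suc[OF assms], unfold that Suc A_bounded_def[of 2] count_mod3_Cons, simp)
    then show ?thesis using Suc by simp
  qed
qed

text \<open>After a largest part \<open>3 l + 2\<close> the tail is bounded by \<open>3 l\<close>,
  since \<open>3 l + 1\<close> is the forbidden partner. Hence bounds that are not divisible by 3
  can be eliminated.\<close>

lemma gf_A_blocks:
  "gf_A 1 (3 * l + 2) i j = gf_A 1 (3 * l) i j +
     (if i = 0 then 0 else fps_X ^ (3 * l + 2) * gf_A 2 (3 * l) (i - 1) j)" (is ?one)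
  "gf_A 2 (3 * l + 2) i j = gf_A 2 (3 * l) i j +
     (if j = 0 then 0 else fps_X ^ (3 * l + 1) * gf_A 1 (3 * l) i (j - 1))" (is ?two)
  "m \<in> {1, 2} \<Longrightarrow> gf_A m (3 * Suc l) i j =
     gf_A m (3 * l + 2) i j + fps_X ^ (3 * l + 3) * gf_A (3 - m) (3 * l + 2) i j"
proof -
  have Suc: "Suc (3 * l) = 3 * l + 1" "Suc (3 * l + 1) = 3 * l + 2" "Suc (3 * l + 2) = 3 * l + 3"
      "3 * l + 1 - 1 = 3 * l" "3 * Suc l = 3 * l + 3"
    by simp_all
  have mod3: "(3 * l + 1) mod 3 = 1" "(3 * l + 2) mod 3 = 2" "(3 * l + 3) mod 3 = 0"
    by presburger+
  have "gf_A 1 (3 * l + 1) i j = gf_A 1 (3 * l) i j"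
    by (rule gf_A_Suc(1)[of 1 "3 * l", unfolded Suc]) (use mod3 in simp_all)
  moreover have "gf_A 1 (3 * l + 2) i j = gf_A 1 (3 * l + 1) i j +
     (if i = 0 then 0 else fps_X ^ (3 * l + 2) * gf_A 2 (3 * l) (i - 1) j)"
    by (rule gf_A_Suc(4)[of 1 "3 * l + 1", unfolded Suc]) (use mod3 in simp_all)
  ultimately show ?one by simp
  have "gf_A 2 (3 * l + 1) i j = gf_A 2 (3 * l) i j +
     (if j = 0 then 0 else fps_X ^ (3 * l + 1) * gf_A 1 (3 * l) i (j - 1))"
    by (rule gf_A_Suc(3)[of 2 "3 * l", unfolded Suc]) (use mod3 in simp_all)
  moreover have "gf_A 2 (3 * l + 2) i j = gf_A 2 (3 * l + 1) i j"
    by (rule gf_A_Suc(1)[of 2 "3 * l + 1", unfolded Suc]) (use mod3 in simp_all)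
  ultimately show ?two by simp
  show "gf_A m (3 * Suc l) i j =
     gf_A m (3 * l + 2) i j + fps_X ^ (3 * l + 3) * gf_A (3 - m) (3 * l + 2) i j"
    if "m \<in> {1, 2}"
    unfolding Suc(5)
    by (rule gf_A_Suc(2)[of m "3 * l + 2", unfolded Suc]) (use that mod3 in simp_all)
qed

text \<open>The four terms are the admissible choices among the top three values: none,
  \<open>3 l + 3\<close> followed by \<open>3 l + 1\<close>, \<open>3 l + 3\<close> alone,
  \<open>3 l + 2\<close> alone. One removal exchanges the values of \<open>m\<close>, two restore
  them.\<close>

lemma gf_A_1_rec:
  "gf_A 1 (3 * Suc l) i j = gf_A 1 (3 * l) i j
     + (if j = 0 then 0 else fps_X ^ (6 * l + 4) * gf_A 1 (3 * l) i (j - 1))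
     + fps_X ^ (3 * l + 3) * gf_A 2 (3 * l) i j
     + (if i = 0 then 0 else fps_X ^ (3 * l + 2) * gf_A 2 (3 * l) (i - 1) j)"
proof -
  have "fps_X ^ (6 * l + 4) = (fps_X ^ (3 * l + 3) * fps_X ^ (3 * l + 1) :: int fps)"
    by (simp only: flip: power_add) simp
  moreover have "gf_A 1 (3 * Suc l) i j =
      gf_A 1 (3 * l + 2) i j + fps_X ^ (3 * l + 3) * gf_A 2 (3 * l + 2) i j"
    using gf_A_blocks(3)[of 1 l i j] by simp
  ultimately show ?thesis
    unfolding gf_A_blocks(1,2) by (simp only: ring_distribs mult.assoc add_ac if_distrib[of "(*) _"]
      mult_zero_right)
qed

text \<open>Here the choices are none, \<open>3 l + 3\<close> followed by \<open>3 l + 2\<close>,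
  \<open>3 l + 3\<close> alone, \<open>3 l + 1\<close> alone.\<close>

lemma gf_A_2_rec:
  "gf_A 2 (3 * Suc l) i j = gf_A 2 (3 * l) i j
     + (if i = 0 then 0 else fps_X ^ (6 * l + 5) * gf_A 2 (3 * l) (i - 1) j)
     + fps_X ^ (3 * l + 3) * gf_A 1 (3 * l) i j
     + (if j = 0 then 0 else fps_X ^ (3 * l + 1) * gf_A 1 (3 * l) i (j - 1))"
proof -
  have "fps_X ^ (6 * l + 5) = (fps_X ^ (3 * l + 3) * fps_X ^ (3 * l + 2) :: int fps)"
    by (simp only: flip: power_add) simp
  moreover have "gf_A 2 (3 * Suc l) i j =
      gf_A 2 (3 * l + 2) i j + fps_X ^ (3 * l + 3) * gf_A 1 (3 * l + 2) i j"
    using gf_A_blocks(3)[of 2 l i j] by simp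
  ultimately show ?thesis
    unfolding gf_A_blocks(1,2) by (simp only: ring_distribs mult.assoc add_ac if_distrib[of "(*) _"]
      mult_zero_right)
qed

section \<open>The closed form\<close>

text \<open>
  The four terms of the recurrences, over the common denominator and with \<open>Q = X\<^sup>3\<close>, sum up by
  \<open>(1 - Q\<^sup>k) (1 + Q\<^bsup>k+2i\<^esup>) + Q\<^bsup>2k+2i\<^esup> (1 - Q\<^bsup>2j\<^esup>) + Q\<^sup>k (1 - Q\<^bsup>2i\<^esup>) = 1 - Q\<^bsup>2(k+i+j)\<^esup>\<close>.
\<close>

lemma combine_terms:
  fixes x M :: "'a::comm_ring_1"
  assumes "a = x ^ e * (1 - x ^ (3 * k)) * M"
    and "b = x ^ (e + 6 * (k + i)) * (1 - x ^ (6 * j)) * M"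
    and "c = x ^ (e + 3 * (k + 2 * i)) * (1 - x ^ (3 * k)) * M"
    and "d = x ^ (e + 3 * k) * (1 - x ^ (6 * i)) * M"
  shows "a + b + c + d = x ^ e * (1 - x ^ (6 * (k + i + j))) * M"
proof -
  define K I J where "K = x ^ (3 * k)" and "I = x ^ (6 * i)" and "J = x ^ (6 * j)"
  \<comment> \<open>Apart from this relation, the powers enter the identity as independent
    symbols.\<close>
  have K2: "x ^ (6 * k) = K * K"
    by (simp add: K_def flip: power_add)
  show ?thesis
    unfolding assms
    by (simp add: power_add distrib_left flip: K_def I_def J_def) (simp only: K2 ring_distribs, simp add: mult_ac)
qed

definition denom :: "nat \<Rightarrow> nat \<Rightarrow> nat \<Rightarrow> int fps" where
  "denom i j k = qp i * qp j * qp k"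

lemma denom_nonzero: "denom i j k \<noteq> 0"
  by (simp add: denom_def qp_nonzero)

lemma denom_Suc:
  "denom (Suc i) j k = (1 - fps_X ^ (6 * Suc i)) * denom i j k"
  "denom i (Suc j) k = (1 - fps_X ^ (6 * Suc j)) * denom i j k"
  "denom i j (Suc k) = (1 - fps_X ^ (6 * Suc k)) * denom i j k"
  by (simp_all add: denom_def qp_Suc mult_ac)

text \<open>The \<open>q\<close>-trinomial coefficient in base \<open>X\<^sup>6\<close> is \<open>qp L / denom i j k\<close>.\<close>

definition closed_form :: "(nat \<Rightarrow> nat \<Rightarrow> nat) \<Rightarrow> nat \<Rightarrow> (nat \<Rightarrow> nat \<Rightarrow> int fps) \<Rightarrow> bool" where
  "closed_form e L f \<longleftrightarrow>
     (\<forall>i j. L < i + j \<longrightarrow> f i j = 0) \<and>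
     (\<forall>i j k. i + j + k = L \<longrightarrow> f i j * denom i j k = fps_X ^ e i j * (qm k * qp L))"

lemma closed_form_vanish: "closed_form e L f \<Longrightarrow> L < i + j \<Longrightarrow> f i j = 0"
  and closed_form_eq: "closed_form e L f \<Longrightarrow> i + j + k = L \<Longrightarrow>
    f i j * denom i j k = fps_X ^ e i j * (qm k * qp L)"
  by (simp_all add: closed_form_def)

text \<open>Puts terms known at level \<open>L\<close> over a denominator of level
  \<open>Suc L\<close>. If \<open>k\<close> is the raised index,
  \<open>1 - X^(6 k) = (1 - X^(3 k)) (1 + X^(3 k))\<close>, and the second factor completes
  \<open>qm (k - 1)\<close> to \<open>qm k\<close>.\<close>

lemma closed_form_times_denom:
  assumes f: "closed_form e L f"
  shows "i + j + k = Suc L \<Longrightarrow>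
      f i j * denom i j k = fps_X ^ e i j * (1 - fps_X ^ (3 * k)) * (qm k * qp L)" (is "_ \<Longrightarrow> ?A")
    and "Suc i + j + k = Suc L \<Longrightarrow>
      f i j * denom (Suc i) j k = fps_X ^ e i j * (1 - fps_X ^ (6 * Suc i)) * (qm k * qp L)"
      (is "_ \<Longrightarrow> ?B")
    and "i + Suc j + k = Suc L \<Longrightarrow>
      f i j * denom i (Suc j) k = fps_X ^ e i j * (1 - fps_X ^ (6 * Suc j)) * (qm k * qp L)"
      (is "_ \<Longrightarrow> ?C")
proof -
  show ?A if "i + j + k = Suc L"
  proof (cases k)
    \<comment> \<open>Here \<open>i + j\<close> exceeds \<open>L\<close>, and both sides are
      zero.\<close>
    case 0
    then show ?thesis using that closed_form_vanish[OF f, of i j] by simp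
  next
    case (Suc k')
    have sq: "1 - fps_X ^ (6 * k) = (1 - fps_X ^ (3 * k)) * (1 + fps_X ^ (3 * k) :: int fps)"
      by (simp add: algebra_simps flip: power_add)
    have "f i j * denom i j k = (1 - fps_X ^ (6 * k)) * (f i j * denom i j k')"
      by (simp only: Suc denom_Suc mult_ac)
    also have "f i j * denom i j k' = fps_X ^ e i j * (qm k' * qp L)"
      by (rule closed_form_eq[OF f]) (use that Suc in simp)
    also have "(1 - fps_X ^ (6 * k)) * (fps_X ^ e i j * (qm k' * qp L)) =
        fps_X ^ e i j * (1 - fps_X ^ (3 * k)) * ((1 + fps_X ^ (3 * k)) * qm k' * qp L)"
      unfolding sq by (simp only: mult_ac)
    finally show ?thesis
      by (simp only: Suc qm_Suc)
  qed
  show ?B if "Suc i + j + k = Suc L"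
    using closed_form_eq[OF f, of i j k] that by (simp only: denom_Suc) (simp add: mult_ac)
  show ?C if "i + Suc j + k = Suc L"
    using closed_form_eq[OF f, of i j k] that by (simp only: denom_Suc) (simp add: mult_ac)
qed

text \<open>Simultaneous induction, as the recurrences are coupled: each of the four terms is
  brought to the form that \<open>combine_terms\<close> expects.\<close>

lemma gf_A_closed_form:
  "closed_form (\<lambda>i j. least_sum 2 i + least_sum 4 j) L (gf_A 1 (3 * L)) \<and>
   closed_form (\<lambda>i j. least_sum 5 i + least_sum 1 j) L (gf_A 2 (3 * L))"
proof (induction L)
  case 0
  show ?case by (auto simp: closed_form_def A_bounded_0 denom_def gf_def)
next
  case (Suc l)
  let ?e = "\<lambda>i j. least_sum 2 i + least_sum 4 j" and ?e' = "\<lambda>i j. least_sum 5 i + least_sum 1 j"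
  let ?u = "gf_A 1 (3 * l)" and ?v = "gf_A 2 (3 * l)"
  have u: "closed_form ?e l ?u" and v: "closed_form ?e' l ?v"
    using Suc.IH by auto
  \<comment> \<open>The first elements of the progressions satisfy \<open>5 = 2 + 3\<close> and
    \<open>4 = 1 + 3\<close>.\<close>
  have e: "?e' i j + 3 * j = ?e i j + 3 * i" for i j
    using least_sum_add[of 2 3 i] least_sum_add[of 1 3 j] by simp
  \<comment> \<open>Aligns the exponent of the mixed term with \<open>X^(3 l + 3)\<close>;
    exchanging \<open>i\<close> with \<open>j\<close> and \<open>c\<close> with \<open>d\<close>
    serves the second recurrence.\<close>
  have shift: "i + j + k = Suc l \<Longrightarrow> c + 3 * j = d + 3 * i \<Longrightarrow> 3 * l + 3 + c = d + 3 * (k + 2 * i)"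
    for i j k c d by simp
  note times_u = closed_form_times_denom[OF u] and times_v = closed_form_times_denom[OF v]
  \<comment> \<open>All four terms vanish: lowering \<open>i\<close> or \<open>j\<close> by one
    still leaves the sum above \<open>l\<close>.\<close>
  have vanish: "gf_A 1 (3 * Suc l) i j = 0 \<and> gf_A 2 (3 * Suc l) i j = 0" if "Suc l < i + j" for i j
  proof -
    have "?u i j = 0" "?v i j = 0"
      "i \<noteq> 0 \<Longrightarrow> ?v (i - 1) j = 0" "j \<noteq> 0 \<Longrightarrow> ?u i (j - 1) = 0"
      using that by (intro closed_form_vanish[OF u] closed_form_vanish[OF v]; simp)+
    then show ?thesis
      unfolding gf_A_1_rec gf_A_2_rec by (cases "i = 0"; cases "j = 0") (simp_all del: One_nat_def)
  qed
  have eq1: "gf_A 1 (3 * Suc l) i j * denom i j k = fps_X ^ ?e i j * (qm k * qp (Suc l))"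
    if l: "i + j + k = Suc l" for i j k
  proof -
    let ?M = "qm k * qp l"
    have "?u i j * denom i j k = fps_X ^ ?e i j * (1 - fps_X ^ (3 * k)) * ?M"
      using times_u(1)[OF l] .
    moreover have "(if j = 0 then 0 else fps_X ^ (6 * l + 4) * ?u i (j - 1)) * denom i j k =
        fps_X ^ (?e i j + 6 * (k + i)) * (1 - fps_X ^ (6 * j)) * ?M"
    proof (cases j)
      case (Suc j')
      have eq: "6 * l + 4 + ?e i j' = ?e i j + 6 * (k + i)" using l Suc by simp
      have "i + Suc j' + k = Suc l" using l Suc by simp
      from shift_power[OF times_u(3)[OF this] eq] show ?thesis
        by (simp only: Suc nat.distinct if_False diff_Suc_1)
    qed simp
    moreover have "fps_X ^ (3 * l + 3) * ?v i j * denom i j k =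
        fps_X ^ (?e i j + 3 * (k + 2 * i)) * (1 - fps_X ^ (3 * k)) * ?M"
    proof -
      have "3 * l + 3 + ?e' i j = ?e i j + 3 * (k + 2 * i)" by (rule shift[OF l e])
      with shift_power[OF times_v(1)[OF l]] show ?thesis by blast
    qed
    moreover have "(if i = 0 then 0 else fps_X ^ (3 * l + 2) * ?v (i - 1) j) * denom i j k =
        fps_X ^ (?e i j + 3 * k) * (1 - fps_X ^ (6 * i)) * ?M"
    proof (cases i)
      case (Suc i')
      have eq: "3 * l + 2 + ?e' i' j = ?e i j + 3 * k" using l Suc e[of i' j] by simp
      have "Suc i' + j + k = Suc l" using l Suc by simp
      from shift_power[OF times_v(2)[OF this] eq] show ?thesis
        by (simp only: Suc nat.distinct if_False diff_Suc_1)
    qed simp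
    ultimately have "gf_A 1 (3 * Suc l) i j * denom i j k =
        fps_X ^ ?e i j * (1 - fps_X ^ (6 * (k + i + j))) * ?M"
      unfolding gf_A_1_rec distrib_right[of _ _ "denom i j k"] by (rule combine_terms)
    moreover have "k + i + j = Suc l" using l by simp
    ultimately show ?thesis by (simp only: qp_Suc mult_ac)
  qed
  have eq2: "gf_A 2 (3 * Suc l) i j * denom i j k = fps_X ^ ?e' i j * (qm k * qp (Suc l))"
    if l: "i + j + k = Suc l" for i j k
  proof -
    let ?M = "qm k * qp l"
    have "?v i j * denom i j k = fps_X ^ ?e' i j * (1 - fps_X ^ (3 * k)) * ?M"
      using times_v(1)[OF l] .
    moreover have "(if i = 0 then 0 else fps_X ^ (6 * l + 5) * ?v (i - 1) j) * denom i j k =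
        fps_X ^ (?e' i j + 6 * (k + j)) * (1 - fps_X ^ (6 * i)) * ?M"
    proof (cases i)
      case (Suc i')
      have eq: "6 * l + 5 + ?e' i' j = ?e' i j + 6 * (k + j)" using l Suc by simp
      have "Suc i' + j + k = Suc l" using l Suc by simp
      from shift_power[OF times_v(2)[OF this] eq] show ?thesis
        by (simp only: Suc nat.distinct if_False diff_Suc_1)
    qed simp
    moreover have "fps_X ^ (3 * l + 3) * ?u i j * denom i j k =
        fps_X ^ (?e' i j + 3 * (k + 2 * j)) * (1 - fps_X ^ (3 * k)) * ?M"
    proof -
      have "3 * l + 3 + ?e i j = ?e' i j + 3 * (k + 2 * j)" by (rule shift[OF _ e[symmetric]]) (use l in simp)
      with shift_power[OF times_u(1)[OF l]] show ?thesis by blast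
    qed
    moreover have "(if j = 0 then 0 else fps_X ^ (3 * l + 1) * ?u i (j - 1)) * denom i j k =
        fps_X ^ (?e' i j + 3 * k) * (1 - fps_X ^ (6 * j)) * ?M"
    proof (cases j)
      case (Suc j')
      have eq: "3 * l + 1 + ?e i j' = ?e' i j + 3 * k" using l Suc e[of i j'] by simp
      have "i + Suc j' + k = Suc l" using l Suc by simp
      from shift_power[OF times_u(3)[OF this] eq] show ?thesis
        by (simp only: Suc nat.distinct if_False diff_Suc_1)
    qed simp
    \<comment> \<open>\<open>combine_terms\<close> is applied with \<open>i\<close> and
      \<open>j\<close> exchanged.\<close>
    ultimately have "gf_A 2 (3 * Suc l) i j * denom i j k =
        fps_X ^ ?e' i j * (1 - fps_X ^ (6 * (k + j + i))) * ?M"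
      unfolding gf_A_2_rec distrib_right[of _ _ "denom i j k"] by (rule combine_terms)
    moreover have "k + j + i = Suc l" using l by simp
    ultimately show ?thesis by (simp only: qp_Suc mult_ac)
  qed
  show ?case
    unfolding closed_form_def using vanish eq1 eq2 by blast
qed

section \<open>Partitions counted by $C_m$\<close>

text \<open>
  On the side of \<open>C\<^sub>m\<close> the bound on the second progression depends on \<open>i\<close>: this produces the
  same trinomial coefficient, and it is harmless since only partitions of a fixed \<open>n\<close> matter.
\<close>

definition C_bounded :: "nat \<Rightarrow> nat \<Rightarrow> nat \<Rightarrow> nat \<Rightarrow> nat \<Rightarrow> (nat set \<times> nat set \<times> nat set) set" where
  "C_bounded r s i j k =
     subsets (progression r (i + (j + k))) i \<times>
     subsets (progression s (j + k)) j \<times> Pow ((\<lambda>t. 3 * t) ` {1..k})"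

abbreviation triple_sum :: "nat set \<times> nat set \<times> nat set \<Rightarrow> nat" where
  "triple_sum \<equiv> \<lambda>(S, T). \<Sum> S + (\<lambda>(T, D). \<Sum> T + \<Sum> D) T"

text \<open>The two Gaussian binomials multiply to the trinomial: \<open>qp (j + k)\<close> is the
  numerator of the second and a factor of the denominator of the first, so it cancels.\<close>

lemma gf_C_bounded:
  "gf triple_sum (C_bounded r s i j k) * denom i j k =
     fps_X ^ (least_sum r i + least_sum s j) * (qm k * qp (i + j + k))"
proof -
  let ?S = "gf \<Sum> (subsets (progression r (i + (j + k))) i)"
  let ?T = "gf \<Sum> (subsets (progression s (j + k)) j)"
  have "gf triple_sum (C_bounded r s i j k) = ?S * (?T * qm k)"
    unfolding C_bounded_def gf_Times gf_Pow_multiples ..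
  then have "gf triple_sum (C_bounded r s i j k) * denom i j k * qp (j + k) =
      (?S * (qp i * qp (j + k))) * (?T * (qp j * qp k)) * qm k"
    by (simp only: denom_def mult_ac)
  also have "\<dots> =
      fps_X ^ (least_sum r i + least_sum s j) * (qm k * qp (i + j + k)) * qp (j + k)"
    unfolding gf_subsets_progression power_add by (simp only: mult_ac add_ac)
  finally show ?thesis
    using qp_nonzero by simp
qed

section \<open>Partitions into distinct parts as finite sets\<close>

lemma card_decreasing_lists:
  fixes Q :: "'a::linorder set \<Rightarrow> bool"
  shows "card {\<pi>. sorted_wrt (>) \<pi> \<and> Q (set \<pi>)} = card {U. finite U \<and> Q U}"
proof (rule bij_betw_same_card)
  show "bij_betw set {\<pi>. sorted_wrt (>) \<pi> \<and> Q (set \<pi>)} {U. finite U \<and> Q U}"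
    unfolding bij_betw_def
  proof
    show "inj_on set {\<pi>. sorted_wrt (>) \<pi> \<and> Q (set \<pi>)}"
    proof (rule inj_onI)
      fix \<pi> \<rho> :: "'a list"
      assume "\<pi> \<in> {\<pi>. sorted_wrt (>) \<pi> \<and> Q (set \<pi>)}" "\<rho> \<in> {\<pi>. sorted_wrt (>) \<pi> \<and> Q (set \<pi>)}"
        and "set \<pi> = set \<rho>"
      \<comment> \<open>Reversed, the lists are strictly increasing and thus determined by their
        sets.\<close>
      then have "rev \<pi> = rev \<rho>"
        by (intro strict_sorted_equal) (simp_all add: sorted_wrt_rev)
      then show "\<pi> = \<rho>" by simp
    qed
    show "set ` {\<pi>. sorted_wrt (>) \<pi> \<and> Q (set \<pi>)} = {U. finite U \<and> Q U}"
    proof (intro equalityI subsetI)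
      fix U assume U: "U \<in> {U. finite U \<and> Q U}"
      have "sorted_wrt (>) (rev (sorted_list_of_set U))"
        by (simp add: sorted_wrt_rev)
      moreover have "set (rev (sorted_list_of_set U)) = U"
        using U by simp
      ultimately show "U \<in> set ` {\<pi>. sorted_wrt (>) \<pi> \<and> Q (set \<pi>)}"
        using U by (metis (mono_tags, lifting) imageI mem_Collect_eq)
    qed auto
  qed
qed

text \<open>The bijection sorts the parts by residue, and union inverts it because the three classes
  are disjoint. With \<open>k = n\<close> every bound in \<open>C_bounded\<close> holds
  automatically, as no part exceeds \<open>n\<close>.\<close>

lemma card_C_bounded:
  assumes "r < 6" "s < 6" "r \<noteq> s" "r mod 3 \<noteq> 0" "s mod 3 \<noteq> 0"
  shows "card {U. finite U \<and> (\<forall>p\<in>U. 0 < p \<and> (p mod 3 = 0 \<or> p mod 6 = r \<or> p mod 6 = s)) \<and>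
              \<Sum> U = n \<and> card {p \<in> U. p mod 6 = r} = i \<and> card {p \<in> U. p mod 6 = s} = j} =
         card {t \<in> C_bounded r s i j n. triple_sum t = n}"
    (is "card ?C = card ?B")
proof (rule bij_betw_same_card)
  let ?f = "\<lambda>U::nat set. ({p \<in> U. p mod 6 = r}, {p \<in> U. p mod 6 = s}, {p \<in> U. p mod 3 = 0})"
  let ?g = "\<lambda>(S :: nat set, T, D). S \<union> T \<union> D"
  have mod3: "p mod 3 \<noteq> 0" if "p mod 6 = r \<or> p mod 6 = s" for p
  proof -
    have "p mod 6 mod 3 = p mod 3"
      by (rule mod_mod_cancel) simp
    with that assms(4,5) show ?thesis by metis
  qed
  have split_sum: "\<Sum> (S \<union> T \<union> D) = triple_sum (S, T, D)"
    if "finite S" "finite T" "finite D" "\<forall>p\<in>S. p mod 6 = r" "\<forall>p\<in>T. p mod 6 = s" "\<forall>p\<in>D. p mod 3 = 0"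
    for S T D :: "nat set"
  proof -
    have "S \<inter> T = {}"
      using that(4,5) assms(3) by (metis (lifting) disjoint_iff)
    moreover have "(S \<union> T) \<inter> D = {}"
      using that(4-6) mod3 by (metis (lifting) Un_iff disjoint_iff)
    ultimately show ?thesis
      using that by (simp add: sum.union_disjoint)
  qed
  have C_split: "?g (?f U) = U" if "U \<in> ?C" for U
  proof -
    have "{p \<in> U. P p} \<union> {p \<in> U. P' p} \<union> {p \<in> U. P'' p} = U"
      if "\<forall>p\<in>U. 0 < p \<and> (P'' p \<or> P p \<or> P' p)" for P P' P''
      using that by blast
    then show ?thesis
      using that unfolding prod.case by blast
  qed
  have B: "finite S \<and> finite T \<and> finite D \<and> card S = i \<and> card T = j \<and> triple_sum (S, T, D) = n \<and>
      (\<forall>p\<in>S. 0 < p \<and> p mod 6 = r) \<and> (\<forall>p\<in>T. 0 < p \<and> p mod 6 = s) \<and> (\<forall>p\<in>D. 0 < p \<and> p mod 3 = 0)"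
    if "(S, T, D) \<in> ?B" for S T D
  proof -
    have sub: "S \<subseteq> progression r (i + (j + n))" "T \<subseteq> progression s (j + n)"
      "D \<subseteq> (\<lambda>t. 3 * t) ` {1..n}" "card S = i" "card T = j" "triple_sum (S, T, D) = n"
      using that by (simp_all add: C_bounded_def subsets_def)
    \<comment> \<open>0 is a multiple of 3 and so lies in neither progression.\<close>
    have "0 < p" if "p mod 6 = r \<or> p mod 6 = s" for p
      using mod3[OF that] by (metis mod_0 neq0_conv)
    then have "\<forall>p\<in>S. 0 < p \<and> p mod 6 = r" "\<forall>p\<in>T. 0 < p \<and> p mod 6 = s"
      using sub(1,2) in_progression_iff[OF assms(1)] in_progression_iff[OF assms(2)] by blast+
    moreover have "\<forall>p\<in>D. 0 < p \<and> p mod 3 = 0"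
      using sub(3) by auto
    moreover have "finite S" "finite T" "finite D"
      using sub(1-3) by (meson finite_progression finite_subset finite_imageI finite_atLeastAtMost)+
    ultimately show ?thesis
      using sub(4-6) by blast
  qed
  have B_split: "?f (?g (S, T, D)) = (S, T, D)" if "(S, T, D) \<in> ?B" for S T D
  proof -
    have filter: "{p \<in> X \<union> Y. P p} = X" if "\<forall>p\<in>X. P p" "\<forall>p\<in>Y. \<not> P p"
      for X Y :: "nat set" and P
      using that by blast
    have S: "\<forall>p\<in>S. p mod 6 = r" and T: "\<forall>p\<in>T. p mod 6 = s" and D: "\<forall>p\<in>D. p mod 3 = 0"
      using B[OF that] by metis+
    have "{p \<in> S \<union> (T \<union> D). p mod 6 = r} = S"
      by (rule filter[OF S]) (use T D mod3 assms(3) in \<open>metis Un_iff\<close>)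
    moreover have "{p \<in> T \<union> (S \<union> D). p mod 6 = s} = T"
      by (rule filter[OF T]) (use S D mod3 assms(3) in \<open>metis Un_iff\<close>)
    moreover have "{p \<in> D \<union> (S \<union> T). p mod 3 = 0} = D"
      by (rule filter[OF D]) (use S T mod3 in \<open>metis Un_iff\<close>)
    ultimately show ?thesis
      by (simp only: prod.case Un_ac)
  qed
  show "bij_betw ?f ?C ?B"
  proof (rule bij_betw_byWitness[where f' = ?g])
    show "\<forall>U\<in>?C. ?g (?f U) = U" using C_split by (rule ballI)
    show "\<forall>t\<in>?B. ?f (?g t) = t"
    proof
      fix t assume t: "t \<in> ?B"
      obtain S T D where "t = (S, T, D)" by (rule prod_cases3)
      with t show "?f (?g t) = t" using B_split[of S T D] by (simp only:)
    qed
    show "?f ` ?C \<subseteq> ?B"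
    proof (rule image_subsetI)
      fix U assume U: "U \<in> ?C"
      then have fin: "finite U" and sum: "\<Sum> U = n"
        and card: "card {p \<in> U. p mod 6 = r} = i" "card {p \<in> U. p mod 6 = s} = j"
        by (simp_all only: mem_Collect_eq)
      have pos: "\<forall>p\<in>U. 0 < p"
        using U unfolding mem_Collect_eq by metis
      have bounds: "0 < p \<and> p \<le> n" if "p \<in> U" for p
        using pos sum that member_le_sum[of p U "\<lambda>p. p"] fin by auto
      have "triple_sum (?f U) = \<Sum> (?g (?f U))"
        unfolding prod.case using fin
        by (intro split_sum[symmetric, unfolded prod.case]) simp_all
      also have "\<dots> = n"
        unfolding C_split[OF U] by (rule sum)
      finally have "triple_sum (?f U) = n" .
      moreover have "{p \<in> U. p mod 6 = r} \<subseteq> progression r (i + (j + n))"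
        "{p \<in> U. p mod 6 = s} \<subseteq> progression s (j + n)"
      proof -
        \<comment> \<open>Strict because \<open>p\<close> is positive:
          \<open>p div 6 < p \<le> n\<close>.\<close>
        have "p div 6 < n" if "p \<in> U" for p
          using bounds[OF that] by linarith
        then show "{p \<in> U. p mod 6 = r} \<subseteq> progression r (i + (j + n))"
          "{p \<in> U. p mod 6 = s} \<subseteq> progression s (j + n)"
          unfolding subset_iff in_progression_iff[OF assms(1)] in_progression_iff[OF assms(2)]
          by (simp_all add: trans_less_add2)
      qed
      moreover have "{p \<in> U. p mod 3 = 0} \<subseteq> (\<lambda>t. 3 * t) ` {1..n}"
      proof
        fix p assume "p \<in> {p \<in> U. p mod 3 = 0}"
        then have "p = 3 * (p div 3)" "p div 3 \<in> {1..n}"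
          using bounds[of p] by auto
        then show "p \<in> (\<lambda>t. 3 * t) ` {1..n}" by blast
      qed
      ultimately show "?f U \<in> ?B"
        using card by (simp add: C_bounded_def subsets_def)
    qed
    show "?g ` ?B \<subseteq> ?C"
    proof (rule image_subsetI)
      fix t assume t: "t \<in> ?B"
      obtain S T D where std: "t = (S, T, D)" by (rule prod_cases3)
      note B = B[OF t[unfolded std]] and split = B_split[OF t[unfolded std]]
      have "\<Sum> (S \<union> T \<union> D) = n"
        using B split_sum[of S T D] by metis
      moreover have "card {p \<in> S \<union> T \<union> D. p mod 6 = r} = i" "card {p \<in> S \<union> T \<union> D. p mod 6 = s} = j"
        using B split by simp_all
      moreover have "\<forall>p\<in>S \<union> T \<union> D. 0 < p \<and> (p mod 3 = 0 \<or> p mod 6 = r \<or> p mod 6 = s)"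
        using B by (metis Un_iff)
      ultimately show "?g t \<in> ?C"
        using B by (simp only: std prod.case mem_Collect_eq finite_Un simp_thms)
    qed
  qed
qed

section \<open>Translation to the original counts and conclusion\<close>

lemma num_parts_cong_eq:
  "num_parts_cong \<pi> (int r) (int q) = length (filter (\<lambda>p. p mod q = r mod q) \<pi>)"
  by (simp only: num_parts_cong_def int_cong_iff)

text \<open>A part of a partition of \<open>n\<close> is at most \<open>n\<close>, so the bound
  \<open>N\<close> excludes nothing.\<close>

lemma A_side:
  assumes "m \<in> {1, 2}" "n \<le> N"
  shows "{\<pi> \<in> A_partitions m n. num_parts_cong \<pi> 2 3 = i \<and> num_parts_cong \<pi> 1 3 = j} =
         {\<pi> \<in> A_bounded m N i j. sum_list \<pi> = n}"
proof -
  have "set \<pi> \<subseteq> {..N}" if "sum_list \<pi> = n" for \<pi>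
    using that assms(2) member_le_sum_list[of _ \<pi>] by fastforce
  moreover have "num_parts_cong \<pi> 2 3 = count_mod3 2 \<pi>" "num_parts_cong \<pi> 1 3 = count_mod3 1 \<pi>" for \<pi>
    using num_parts_cong_eq[of \<pi> 2 3] num_parts_cong_eq[of \<pi> 1 3] by (simp_all add: count_mod3_def)
  ultimately show ?thesis
    unfolding A_bounded_def A_partitions_eq[OF assms(1)] by auto
qed

text \<open>\<open>r\<close> and \<open>s\<close> are \<open>3 m - 1\<close> and
  \<open>3 m + 1\<close> reduced modulo 6, so 7 becomes 1 for \<open>m = 2\<close>. Together with 0
  and 3 they are exactly the residues other than \<open>m\<close> and \<open>- m\<close>.\<close>

lemma C_side:
  assumes "(m, r, s) \<in> {(1, 2, 4), (2, 5, 1)}"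
  shows "card {\<pi> \<in> C_partitions m n. num_parts_cong \<pi> (3 * int m - 1) 6 = i \<and>
                 num_parts_cong \<pi> (3 * int m + 1) 6 = j} =
         card {t \<in> C_bounded r s i j n. triple_sum t = n}"
proof -
  let ?Q = "\<lambda>U. (\<forall>p\<in>U. 0 < p \<and> (p mod 3 = 0 \<or> p mod 6 = r \<or> p mod 6 = s)) \<and>
              \<Sum> U = n \<and> card {p \<in> U. p mod 6 = r} = i \<and> card {p \<in> U. p mod 6 = s} = j"
  have residues: "\<not> [int p = int m] (mod 6) \<and> \<not> [int p = - int m] (mod 6) \<longleftrightarrow>
      p mod 3 = 0 \<or> p mod 6 = r \<or> p mod 6 = s" for p
    using assms by (auto simp: cong_def) presburger+
  have "num_parts_cong \<pi> (3 * int m - 1) 6 = length (filter (\<lambda>p. p mod 6 = r) \<pi>)"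
      "num_parts_cong \<pi> (3 * int m + 1) 6 = length (filter (\<lambda>p. p mod 6 = s) \<pi>)" for \<pi>
    using assms num_parts_cong_eq[of \<pi> "3 * m - 1" 6] num_parts_cong_eq[of \<pi> "3 * m + 1" 6] by auto
  moreover have "length (filter P \<pi>) = card {p \<in> set \<pi>. P p}" if "distinct \<pi>"
    for \<pi> :: "nat list" and P
    using that by (simp add: distinct_length_filter Int_def conj_commute)
  moreover have "sum_list \<pi> = \<Sum> (set \<pi>)" if "distinct \<pi>" for \<pi> :: "nat list"
    using that by (simp add: distinct_sum_list_conv_Sum)
  ultimately have "{\<pi> \<in> C_partitions m n. num_parts_cong \<pi> (3 * int m - 1) 6 = i \<and>
      num_parts_cong \<pi> (3 * int m + 1) 6 = j} = {\<pi>. sorted_wrt (>) \<pi> \<and> ?Q (set \<pi>)}"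
    unfolding C_partitions_def partition_of_def sorted_wrt_greater_iff residues by auto
  then have "card {\<pi> \<in> C_partitions m n. num_parts_cong \<pi> (3 * int m - 1) 6 = i \<and>
      num_parts_cong \<pi> (3 * int m + 1) 6 = j} = card {U. finite U \<and> ?Q U}"
    using card_decreasing_lists[of ?Q] by simp
  also have "\<dots> = card {t \<in> C_bounded r s i j n. triple_sum t = n}"
    by (rule card_C_bounded) (use assms in auto)
  finally show ?thesis .
qed

theorem theorem3p5:
  fixes n i j m :: nat
  assumes "m \<in> {1, 2}"
  shows "card {\<pi> \<in> A_partitions m n.
                 num_parts_cong \<pi> 2 3 = i \<and> num_parts_cong \<pi> 1 3 = j} =
         card {\<pi> \<in> C_partitions m n.
                 num_parts_cong \<pi> (3 * int m - 1) 6 = i \<and>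
                 num_parts_cong \<pi> (3 * int m + 1) 6 = j}"
proof -
  \<comment> \<open>This makes the third index \<open>k = L - i - j\<close> equal to
    \<open>n\<close> and the bound \<open>3 L\<close> at least \<open>n\<close>.\<close>
  define L where "L = i + j + n"
  obtain r s :: nat where rs: "(m, r, s) \<in> {(1, 2, 4), (2, 5, 1)}"
    using assms by auto
  have "closed_form (\<lambda>i j. least_sum r i + least_sum s j) L (gf_A m (3 * L))"
    using gf_A_closed_form[of L] rs by auto
  then have "gf_A m (3 * L) i j * denom i j n = gf triple_sum (C_bounded r s i j n) * denom i j n"
    unfolding gf_C_bounded L_def by (rule closed_form_eq) simp
  then have eq: "gf_A m (3 * L) i j = gf triple_sum (C_bounded r s i j n)"
    using denom_nonzero by simp
  have "finite (C_bounded r s i j n)"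
    by (simp add: C_bounded_def)
  \<comment> \<open>Compare the coefficients of \<open>X^n\<close>.\<close>
  then have "card {\<pi> \<in> A_bounded m (3 * L) i j. sum_list \<pi> = n} =
      card {t \<in> C_bounded r s i j n. triple_sum t = n}"
    using arg_cong[OF eq, of "\<lambda>f. fps_nth f n"] by (simp only: fps_nth_gf finite_A_bounded of_nat_eq_iff)
  then show ?thesis
    unfolding C_side[OF rs] using A_side[OF assms, of n "3 * L" i j] by (simp add: L_def)
qed

end
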